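(* Let $\Sigma$ be a structurally well-posed $n\times n$ signature matrix, let $(c,d)$ be a valid offset vector of $\Sigma$, and let $S_0=S_0(c,d)$ be its Jacobian sparsity pattern. Let $(\rho,\kappa,(N_1,\ldots,N_p))$ be a permuted square-block form that puts $S_0$ into irreducible block-triangular form. Then, modulo the permutation, the essential sparsity pattern $S_{\mathrm{ess}}$ of $\Sigma$ equals the union of the diagonal blocks of $S_0$; that is, $$\widetilde{S}_{\mathrm{ess}}=\bigcup_{l=1}^p \big(\widetilde S_0\cap(B_l\times B_l)\big).$$ Hence $S_0$ and $S_{\mathrm{ess}}$ have the same irreducible emblem.
   Context: A signature matrix is an $n\times n$ matrix $\Sigma=(\sigma_{ij})$ with entries in $\mathbb{Z}_{\ge0}\cup\{-\infty\}$. A transversal is a set $T$ of $n$ positions $(i,j)$ with exactly one in each row and each column; its value is $\sum_{(i,j)\in T}\sigma_{ij}$. $\Sigma$ is structurally well-posed if it has a transversal on which all $\sigma_{ij}$ are finite. A highest-value transversal (HVT) is a transversal of maximal value. The essential sparsity pattern $S_{\mathrm{ess}}$ is the union of all HVTs of $\Sigma$. A valid offset vector of $\Sigma$ is a pair $(c,d)$ of integer $n$-vectors with $c_i\ge0$ for all $i$, $d_j-c_i\ge\sigma_{ij}$ for all $i,j$, and $d_j-c_i=\sigma_{ij}$ for all $(i,j)$ on some HVT (equivalently, on every HVT). Its Jacobian sparsity pattern is $S_0(c,d)=\{(i,j): d_j-c_i=\sigma_{ij}\}$. A sparsity pattern is a subset $A$ of $\{1,\ldots,n\}^2$. A permuted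 square-block form consists of permutations $\rho$ (of rows) and $\kappa$ (of columns) of $\{1,\ldots,n\}$ together with positive integers $N_1,\ldots,N_p$ summing to $n$. Put $B_l=\{i : \sum_{r<l}N_r < i\le \sum_{r\le l}N_r\}$. The permuted pattern is $\widetilde A=\{(i,j):(\rho(i),\kappa(j))\in A\}$. The form puts $A$ into (upper) block-triangular form (BTF) if $\widetilde A\cap(B_k\times B_l)=\emptyset$ whenever $k>l$. A pattern is structurally nonsingular if it contains a transversal; a structurally nonsingular pattern is irreducible if no permuted square-block form with $p>1$ blocks puts it into BTF. A BTF of $A$ is irreducible if each diagonal sub-pattern $\widetilde A\cap(B_l\times B_l)$ is irreducible as an $N_l\times N_l$ pattern. The emblem of a permuted square-block form is the set of pairs $\{(R_1,C_1),\ldots,(R_p,C_p)\}$ where $R_l=\rho(B_l)$ and $C_l=\kappa(B_l)$ are the sets of original row and column labels in block $l$. Every structurally nonsingular pattern has an irreducible BTF, and all its irreducible BTFs have the same emblem, called its irreducible emblem. *)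

theory Defs
  imports
    "HOL-Library.Extended"
    "HOL-Combinatorics.Permutations"
begin

text \<open>
  Matrices and patterns of size \<open>n\<close> have rows and columns indexed by \<open>{1..n}\<close>; values of functions
  outside this range are irrelevant.  In the type \<^typ>\<open>int extended\<close>, \<open>Minf\<close> plays the role of
  \<open>-\<infinity>\<close>; the value \<open>Pinf\<close> and negative integers are excluded as entries.
\<close>

definition signature_matrix :: "nat \<Rightarrow> (nat \<Rightarrow> nat \<Rightarrow> int extended) \<Rightarrow> bool" where
  "signature_matrix n \<sigma> \<longleftrightarrow>
     (\<forall>i\<in>{1..n}. \<forall>j\<in>{1..n}. \<sigma> i j = Minf \<or> (\<exists>k\<ge>0. \<sigma> i j = Fin k))"

definition transversal :: "nat \<Rightarrow> (nat \<times> nat) set \<Rightarrow> bool" where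
  "transversal n T \<longleftrightarrow>
     T \<subseteq> {1..n} \<times> {1..n} \<and>
     (\<forall>i\<in>{1..n}. \<exists>!j. (i, j) \<in> T) \<and>
     (\<forall>j\<in>{1..n}. \<exists>!i. (i, j) \<in> T)"

definition transversal_value ::
    "(nat \<Rightarrow> nat \<Rightarrow> int extended) \<Rightarrow> (nat \<times> nat) set \<Rightarrow> int extended" where
  "transversal_value \<sigma> T = (\<Sum>(i, j)\<in>T. \<sigma> i j)"

definition structurally_well_posed :: "nat \<Rightarrow> (nat \<Rightarrow> nat \<Rightarrow> int extended) \<Rightarrow> bool" where
  "structurally_well_posed n \<sigma> \<longleftrightarrow>
     (\<exists>T. transversal n T \<and> (\<forall>(i, j)\<in>T. \<exists>k. \<sigma> i j = Fin k))"

definition HVT :: "nat \<Rightarrow> (nat \<Rightarrow> nat \<Rightarrow> int extended) \<Rightarrow> (nat \<times> nat) set \<Rightarrow> bool" where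
  "HVT n \<sigma> T \<longleftrightarrow>
     transversal n T \<and>
     (\<forall>T'. transversal n T' \<longrightarrow> transversal_value \<sigma> T' \<le> transversal_value \<sigma> T)"

definition ess_pattern :: "nat \<Rightarrow> (nat \<Rightarrow> nat \<Rightarrow> int extended) \<Rightarrow> (nat \<times> nat) set" where
  "ess_pattern n \<sigma> = \<Union>{T. HVT n \<sigma> T}"

definition valid_offset ::
    "nat \<Rightarrow> (nat \<Rightarrow> nat \<Rightarrow> int extended) \<Rightarrow> (nat \<Rightarrow> int) \<Rightarrow> (nat \<Rightarrow> int) \<Rightarrow> bool" where
  "valid_offset n \<sigma> c d \<longleftrightarrow>
     (\<forall>i\<in>{1..n}. 0 \<le> c i) \<and>
     (\<forall>i\<in>{1..n}. \<forall>j\<in>{1..n}. \<sigma> i j \<le> Fin (d j - c i)) \<and>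
     (\<exists>T. HVT n \<sigma> T \<and> (\<forall>(i, j)\<in>T. Fin (d j - c i) = \<sigma> i j))"

definition jac_pattern ::
    "nat \<Rightarrow> (nat \<Rightarrow> nat \<Rightarrow> int extended) \<Rightarrow> (nat \<Rightarrow> int) \<Rightarrow> (nat \<Rightarrow> int) \<Rightarrow> (nat \<times> nat) set" where
  "jac_pattern n \<sigma> c d =
     {(i, j). i \<in> {1..n} \<and> j \<in> {1..n} \<and> Fin (d j - c i) = \<sigma> i j}"

text \<open>
  A permuted square-block form is given by \<open>\<rho>\<close>, \<open>\<kappa>\<close> and the list \<open>Ns\<close> of block sizes.  Row and column
  labels start at 1, but blocks are numbered from 0 as list positions, so \<open>block Ns l\<close> is the
  \<open>(l + 1)\<close>-st block.
\<close>

definition square_block_form :: "nat \<Rightarrow> (nat \<Rightarrow> nat) \<Rightarrow> (nat \<Rightarrow> nat) \<Rightarrow> nat list \<Rightarrow> bool" where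
  "square_block_form n \<rho> \<kappa> Ns \<longleftrightarrow>
     \<rho> permutes {1..n} \<and> \<kappa> permutes {1..n} \<and> (\<forall>N\<in>set Ns. 0 < N) \<and> sum_list Ns = n"

definition block_offset :: "nat list \<Rightarrow> nat \<Rightarrow> nat" where
  "block_offset Ns l = sum_list (take l Ns)"

definition block :: "nat list \<Rightarrow> nat \<Rightarrow> nat set" where
  "block Ns l = {i. block_offset Ns l < i \<and> i \<le> block_offset Ns (Suc l)}"

definition permuted_pattern ::
    "nat \<Rightarrow> (nat \<Rightarrow> nat) \<Rightarrow> (nat \<Rightarrow> nat) \<Rightarrow> (nat \<times> nat) set \<Rightarrow> (nat \<times> nat) set" where
  "permuted_pattern n \<rho> \<kappa> A = {(i, j). i \<in> {1..n} \<and> j \<in> {1..n} \<and> (\<rho> i, \<kappa> j) \<in> A}"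

definition BTF ::
    "nat \<Rightarrow> (nat \<Rightarrow> nat) \<Rightarrow> (nat \<Rightarrow> nat) \<Rightarrow> nat list \<Rightarrow> (nat \<times> nat) set \<Rightarrow> bool" where
  "BTF n \<rho> \<kappa> Ns A \<longleftrightarrow>
     square_block_form n \<rho> \<kappa> Ns \<and>
     (\<forall>k<length Ns. \<forall>l<length Ns. l < k \<longrightarrow>
        permuted_pattern n \<rho> \<kappa> A \<inter> (block Ns k \<times> block Ns l) = {})"

definition structurally_nonsingular :: "nat \<Rightarrow> (nat \<times> nat) set \<Rightarrow> bool" where
  "structurally_nonsingular n A \<longleftrightarrow> (\<exists>T. transversal n T \<and> T \<subseteq> A)"

definition irreducible_pattern :: "nat \<Rightarrow> (nat \<times> nat) set \<Rightarrow> bool" where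
  "irreducible_pattern n A \<longleftrightarrow>
     structurally_nonsingular n A \<and>
     \<not> (\<exists>\<rho> \<kappa> Ns. length Ns > 1 \<and> BTF n \<rho> \<kappa> Ns A)"

text \<open>
  The diagonal sub-pattern of the already permuted pattern \<open>A'\<close> on block \<open>l\<close>, with its indices
  shifted down so that it becomes a pattern of size \<open>Ns ! l\<close>.
\<close>

definition diag_subpattern :: "nat list \<Rightarrow> nat \<Rightarrow> (nat \<times> nat) set \<Rightarrow> (nat \<times> nat) set" where
  "diag_subpattern Ns l A' =
     {(i, j). i \<in> {1..Ns ! l} \<and> j \<in> {1..Ns ! l} \<and>
              (block_offset Ns l + i, block_offset Ns l + j) \<in> A'}"

definition irreducible_BTF ::
    "nat \<Rightarrow> (nat \<Rightarrow> nat) \<Rightarrow> (nat \<Rightarrow> nat) \<Rightarrow> nat list \<Rightarrow> (nat \<times> nat) set \<Rightarrow> bool" where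
  "irreducible_BTF n \<rho> \<kappa> Ns A \<longleftrightarrow>
     BTF n \<rho> \<kappa> Ns A \<and>
     (\<forall>l<length Ns. irreducible_pattern (Ns ! l) (diag_subpattern Ns l (permuted_pattern n \<rho> \<kappa> A)))"

definition emblem :: "(nat \<Rightarrow> nat) \<Rightarrow> (nat \<Rightarrow> nat) \<Rightarrow> nat list \<Rightarrow> (nat set \<times> nat set) set" where
  "emblem \<rho> \<kappa> Ns = (\<lambda>l. (\<rho> ` block Ns l, \<kappa> ` block Ns l)) ` {..<length Ns}"

text \<open>
  \<open>E\<close> is \<^emph>\<open>the\<close> irreducible emblem of \<open>A\<close>: an irreducible BTF of \<open>A\<close> exists, and every one has
  emblem \<open>E\<close>.  In particular, at most one \<open>E\<close> satisfies this for given \<open>A\<close>.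
\<close>

definition is_irreducible_emblem ::
    "nat \<Rightarrow> (nat \<times> nat) set \<Rightarrow> (nat set \<times> nat set) set \<Rightarrow> bool" where
  "is_irreducible_emblem n A E \<longleftrightarrow>
     (\<exists>\<rho> \<kappa> Ns. irreducible_BTF n \<rho> \<kappa> Ns A) \<and>
     (\<forall>\<rho> \<kappa> Ns. irreducible_BTF n \<rho> \<kappa> Ns A \<longrightarrow> emblem \<rho> \<kappa> Ns = E)"

end

(*
  The offsets bound the value of every transversal by the sum of the d j minus the sum of the c i,
  with equality exactly for the transversals inside S_0; so S_ess is the union of the transversals
  contained in S_0. In a BTF every transversal stays in the diagonal blocks, by summing block numbers
  over rows and columns. Conversely, after fixing a transversal, an irreducible block is a strongly
  connected digraph, so each of its entries lies on a cycle and hence on another transversal. The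
  blocks are thus the connected components of the bipartite graph formed by all transversals in the
  pattern, which is the same graph for S_0 and for S_ess.
*)

theory Submission
  imports Defs
begin

section \<open>Transversals as bijections\<close>

text \<open>Bijections can be composed with permutations and used to reindex sums, which a set of
  positions does not allow directly. Only the values of \<open>f\<close> on \<open>{1..n}\<close>
  matter.\<close>

lemma transversal_iff_bij:
  "transversal n T \<longleftrightarrow> (\<exists>f. bij_betw f {1..n} {1..n} \<and> T = (\<lambda>i. (i, f i)) ` {1..n})"
proof
  assume T: "transversal n T"
  define f where "f i = (THE j. (i, j) \<in> T)" for i
  have f: "(i, f i) \<in> T" if "i \<in> {1..n}" for i
    unfolding f_def by (rule theI') (use T that in \<open>simp add: transversal_def\<close>)
  have sub: "T \<subseteq> {1..n} \<times> {1..n}"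
    using T by (simp add: transversal_def)
  have f_unique: "f i = j" if "(i, j) \<in> T" for i j
    using that f[of i] T sub unfolding transversal_def by blast
  have "inj_on f {1..n}"
  proof (rule inj_onI)
    fix x y assume "x \<in> {1..n}" "y \<in> {1..n}" "f x = f y"
    then have "(x, f x) \<in> T" "(y, f x) \<in> T" using f by force+
    then show "x = y" using T sub unfolding transversal_def by blast
  qed
  moreover have "f ` {1..n} = {1..n}"
    using calculation f sub by (intro endo_inj_surj) blast+
  ultimately have "bij_betw f {1..n} {1..n}"
    by (simp add: bij_betw_def)
  moreover have "T = (\<lambda>i. (i, f i)) ` {1..n}"
    using f f_unique sub by (force simp del: atLeastAtMost_iff)
  ultimately show "\<exists>f. bij_betw f {1..n} {1..n} \<and> T = (\<lambda>i. (i, f i)) ` {1..n}"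
    by blast
next
  assume "\<exists>f. bij_betw f {1..n} {1..n} \<and> T = (\<lambda>i. (i, f i)) ` {1..n}"
  then obtain f where f: "bij_betw f {1..n} {1..n}" and T: "T = (\<lambda>i. (i, f i)) ` {1..n}"
    by blast
  have col: "\<exists>!i. (i, j) \<in> T" if j: "j \<in> {1..n}" for j
  proof -
    obtain i where "i \<in> {1..n}" "j = f i"
      using f j unfolding bij_betw_def by blast
    moreover have "inj_on f {1..n}"
      using f by (rule bij_betw_imp_inj_on)
    ultimately show ?thesis
      unfolding T by (intro ex1I[of _ i]) (auto dest: inj_onD)
  qed
  have row: "\<exists>!j. (i, j) \<in> T" if "i \<in> {1..n}" for i
    using that unfolding T by (intro ex1I[of _ "f i"]) auto
  have sub: "T \<subseteq> {1..n} \<times> {1..n}"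
    using f unfolding T bij_betw_def by auto
  show "transversal n T"
    unfolding transversal_def by (intro conjI ballI sub row col)
qed

text \<open>In the bipartite graph with edge set \<open>A\<close> these are the allowed edges, those
  lying on a perfect matching.\<close>

definition transversal_union :: "nat \<Rightarrow> (nat \<times> nat) set \<Rightarrow> (nat \<times> nat) set" where
  "transversal_union n A = \<Union>{T. transversal n T \<and> T \<subseteq> A}"

lemma transversal_union_iff:
  "(i, j) \<in> transversal_union n A \<longleftrightarrow>
     i \<in> {1..n} \<and> (\<exists>f. bij_betw f {1..n} {1..n} \<and> (\<forall>x\<in>{1..n}. (x, f x) \<in> A) \<and> f i = j)"
  unfolding transversal_union_def transversal_iff_bij by auto

lemma transversal_union_idem: "transversal_union n (transversal_union n A) = transversal_union n A"
  unfolding transversal_union_def by blast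

section \<open>Highest-value transversals\<close>

text \<open>The bounds exclude \<open>Pinf\<close>, and \<open>Minf\<close> absorbs the remaining
  values, so a finite sum has only finite terms. For those, equality of the sums forces equality in
  each term.\<close>

lemma sum_extended_le_Fin:
  fixes s :: "'a \<Rightarrow> int extended"
  assumes "finite A" "\<And>x. x \<in> A \<Longrightarrow> s x \<le> Fin (w x)"
  shows "sum s A \<le> Fin (sum w A) \<and> (sum s A = Fin (sum w A) \<longleftrightarrow> (\<forall>x\<in>A. s x = Fin (w x)))"
  using assms
proof (induction A rule: finite_induct)
  case empty
  then show ?case by (simp add: zero_extended_def)
next
  case (insert a A)
  then have "sum s A \<le> Fin (sum w A)" "sum s A = Fin (sum w A) \<longleftrightarrow> (\<forall>x\<in>A. s x = Fin (w x))"
    "s a \<le> Fin (w a)" by auto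
  then show ?case
    using insert.hyps by (cases "sum s A"; cases "s a") auto
qed

text \<open>Weak duality and complementary slackness for the assignment problem: the offsets form a
  dual feasible solution with objective value \<open>v\<close>.\<close>

lemma HVT_iff_transversal_jac_pattern:
  assumes "valid_offset n \<sigma> c d"
  shows "HVT n \<sigma> T \<longleftrightarrow> transversal n T \<and> T \<subseteq> jac_pattern n \<sigma> c d"
proof -
  define v where "v = (\<Sum>j\<in>{1..n}. d j) - (\<Sum>i\<in>{1..n}. c i)"
  have bound: "transversal_value \<sigma> T \<le> Fin v \<and>
      (transversal_value \<sigma> T = Fin v \<longleftrightarrow> T \<subseteq> jac_pattern n \<sigma> c d)" if tT: "transversal n T" for T
  proof -
    obtain f where f: "bij_betw f {1..n} {1..n}" and T: "T = (\<lambda>i. (i, f i)) ` {1..n}"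
      using tT unfolding transversal_iff_bij by blast
    have fi: "f i \<in> {1..n}" if "i \<in> {1..n}" for i
      using f that by (rule bij_betwE[THEN bspec])
    have "inj_on (\<lambda>i. (i, f i)) {1..n}"
      by (auto simp: inj_on_def)
    then have val: "transversal_value \<sigma> T = (\<Sum>i\<in>{1..n}. \<sigma> i (f i))"
      unfolding transversal_value_def T by (subst sum.reindex) auto
    have "(\<Sum>i\<in>{1..n}. d (f i) - c i) = v"
      unfolding v_def sum_subtractf using sum.reindex_bij_betw[OF f, of d] by simp
    moreover have "\<sigma> i (f i) \<le> Fin (d (f i) - c i)" if "i \<in> {1..n}" for i
      using assms that fi[OF that] unfolding valid_offset_def by blast
    moreover have "T \<subseteq> jac_pattern n \<sigma> c d \<longleftrightarrow> (\<forall>i\<in>{1..n}. \<sigma> i (f i) = Fin (d (f i) - c i))"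
      unfolding T jac_pattern_def using fi by fastforce
    ultimately show ?thesis
      using sum_extended_le_Fin[of "{1..n}" "\<lambda>i. \<sigma> i (f i)" "\<lambda>i. d (f i) - c i"] val by simp
  qed
  obtain T0 where T0: "HVT n \<sigma> T0" "\<forall>(i, j)\<in>T0. Fin (d j - c i) = \<sigma> i j"
    using assms unfolding valid_offset_def by blast
  then have tr: "transversal n T0"
    by (simp add: HVT_def)
  then have "T0 \<subseteq> {1..n} \<times> {1..n}"
    by (simp add: transversal_def)
  then have "T0 \<subseteq> jac_pattern n \<sigma> c d"
    using T0(2) unfolding jac_pattern_def by auto
  \<comment> \<open>The transversal supplied by \<open>valid_offset\<close> attains the bound, so
    \<open>Fin v\<close> is the maximal value.\<close>
  then have "transversal_value \<sigma> T0 = Fin v"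
    using bound tr by blast
  then show ?thesis
    using bound tr unfolding HVT_def by (metis order_antisym)
qed

lemma ess_pattern_eq_transversal_union:
  assumes "valid_offset n \<sigma> c d"
  shows "ess_pattern n \<sigma> = transversal_union n (jac_pattern n \<sigma> c d)"
  unfolding ess_pattern_def transversal_union_def HVT_iff_transversal_jac_pattern[OF assms] ..

section \<open>Paths and strong connectivity\<close>

text \<open>
  A simple path from \<open>x\<close> to \<open>y\<close> with vertex set \<open>X\<close>, closed up to a cyclic permutation \<open>p\<close> by
  sending \<open>y\<close> back to \<open>x\<close>.
\<close>

inductive path_cycle :: "('a \<times> 'a) set \<Rightarrow> 'a \<Rightarrow> 'a set \<Rightarrow> ('a \<Rightarrow> 'a) \<Rightarrow> 'a \<Rightarrow> bool" for E x where
  start: "path_cycle E x {x} id x"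
| extend: "path_cycle E x X p y \<Longrightarrow> (y, z) \<in> E \<Longrightarrow> z \<notin> X \<Longrightarrow>
    path_cycle E x (insert z X) (p \<circ> transpose y z) z"

text \<open>A fresh \<open>z\<close> is fixed by \<open>p\<close>, so precomposing with
  \<open>transpose y z\<close> sends \<open>y\<close> to \<open>z\<close>, sends \<open>z\<close> to
  \<open>p y = x\<close>, and changes nothing else. The last conjunct serves to keep the cycle
  inside the index range.\<close>

lemma path_cycle_permutation:
  assumes "path_cycle E x X p y"
  shows "p permutes X \<and> x \<in> X \<and> y \<in> X \<and> p y = x \<and> (\<forall>u\<in>X - {y}. (u, p u) \<in> E) \<and>
    X \<subseteq> insert x (snd ` E)"
  using assms
proof induction
  case start
  then show ?case by (simp add: id_def)
next
  case (extend X p y z)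
  then have p: "p permutes X" and [simp]: "y \<noteq> z" "p z = z" "p y = x"
    by (auto simp: permutes_not_in)
  have "p \<circ> transpose y z permutes insert z X"
    using extend by (intro permutes_compose permutes_swap_id permutes_subset[OF p]) auto
  moreover have "(u, (p \<circ> transpose y z) u) \<in> E" if "u \<in> insert z X - {z}" for u
    using extend that by (cases "u = y") (auto simp: transpose_def)
  moreover have "z \<in> snd ` E"
    using extend.hyps(2) by force
  moreover have "(p \<circ> transpose y z) z = x"
    by simp
  ultimately show ?case
    using extend.IH by blast
qed

text \<open>The path is cut off when it arrives at \<open>u\<close>.\<close>

lemma path_cycle_vertex:
  assumes "path_cycle E x X p y" "u \<in> X"
  shows "\<exists>X' p'. path_cycle E x X' p' u"
  using assms by induction (auto intro: path_cycle.intros)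

lemma rtrancl_imp_path_cycle:
  assumes "(x, y) \<in> E\<^sup>*"
  shows "\<exists>X p. path_cycle E x X p y"
  using assms
proof induction
  case base
  show ?case by (blast intro: path_cycle.start)
next
  case (step y z)
  then obtain X p where "path_cycle E x X p y" by blast
  then show ?case
    \<comment> \<open>If the walk revisits \<open>z\<close>, the path is cut back to
      \<open>z\<close>; otherwise it is extended.\<close>
    using step.hyps(2) path_cycle_vertex path_cycle.extend by (cases "z \<in> X") fast+
qed

text \<open>Blocks are intervals of positions, so an arbitrary set of labels must be moved to an
  initial segment before it can form the first block.\<close>

lemma exists_permutation_prefix:
  fixes S :: "nat set"
  assumes "S \<subseteq> {1..N}"
  shows "\<exists>p. p permutes {1..N} \<and> p ` {1..card S} = S"
proof -
  have fin: "finite S" using assms by (rule finite_subset) simp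
  have le: "card S \<le> N" using card_mono[OF _ assms] by simp
  obtain g where g: "bij_betw g {1..card S} S"
    using finite_same_card_bij[of "{1..card S}" S] fin by auto
  have "card {card S + 1..N} = card ({1..N} - S)"
    using assms fin by (simp add: card_Diff_subset)
  then obtain h where h: "bij_betw h {card S + 1..N} ({1..N} - S)"
    using finite_same_card_bij[of "{card S + 1..N}" "{1..N} - S"] by auto
  define p where "p i = (if i \<in> {1..card S} then g i else if i \<in> {1..N} then h i else i)" for i
  have pg: "bij_betw p {1..card S} S"
    using g by (rule bij_betw_cong[THEN iffD1, rotated]) (simp add: p_def)
  have ph: "bij_betw p {card S + 1..N} ({1..N} - S)"
    using h by (rule bij_betw_cong[THEN iffD1, rotated]) (simp add: p_def)
  have "bij_betw p ({1..card S} \<union> {card S + 1..N}) (S \<union> ({1..N} - S))"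
    using pg ph by (rule bij_betw_combine) auto
  moreover have "{1..card S} \<union> {card S + 1..N} = {1..N}" using le by auto
  moreover have "S \<union> ({1..N} - S) = {1..N}" using assms by auto
  ultimately have "bij_betw p {1..N} {1..N}" by simp
  then have "p permutes {1..N}"
    by (rule bij_imp_permutes) (use le in \<open>auto simp: p_def\<close>)
  then show ?thesis
    using pg unfolding bij_betw_def by blast
qed

lemma rtrancl_map:
  assumes "(x, y) \<in> r\<^sup>*" "\<And>x y. (x, y) \<in> r \<Longrightarrow> (f x, f y) \<in> s"
  shows "(f x, f y) \<in> s\<^sup>*"
  using assms(1) by induction (auto intro: assms(2) rtrancl_into_rtrancl)

text \<open>The digraph obtained from the bipartite graph \<open>A\<close> by contracting each
  matching edge \<open>(y, f y)\<close> to the single vertex \<open>y\<close>.\<close>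

definition match_graph :: "nat set \<Rightarrow> (nat \<Rightarrow> nat) \<Rightarrow> (nat \<times> nat) set \<Rightarrow> (nat \<times> nat) set" where
  "match_graph V f A = {(x, y). x \<in> V \<and> y \<in> V \<and> (x, f y) \<in> A}"

text \<open>
  If the set reachable from \<open>x\<close> were proper, listing its complement first would give a BTF with
  two blocks.
\<close>

lemma irreducible_strongly_connected:
  assumes irr: "irreducible_pattern N A"
    and f: "bij_betw f {1..N} {1..N}"
    and x: "x \<in> {1..N}" and y: "y \<in> {1..N}"
  shows "(x, y) \<in> (match_graph {1..N} f A)\<^sup>*"
proof (rule ccontr)
  assume nreach: "(x, y) \<notin> (match_graph {1..N} f A)\<^sup>*"
  define S where "S = {z \<in> {1..N}. (x, z) \<notin> (match_graph {1..N} f A)\<^sup>*}"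
  have S: "S \<subseteq> {1..N}" "y \<in> S" "x \<notin> S"
    using nreach x y by (auto simp: S_def)
  \<comment> \<open>Such an entry would be an edge from \<open>u\<close> to \<open>v\<close>, making
    \<open>v\<close> reachable along with \<open>u\<close>.\<close>
  have closed: "(u, f v) \<notin> A" if "u \<in> {1..N} - S" "v \<in> S" for u v
    using that unfolding S_def match_graph_def by (auto dest: rtrancl_into_rtrancl)
  define m where "m = card S"
  have "m > 0"
    using S finite_subset[OF S(1)] by (auto simp: m_def card_gt_0_iff)
  have "m < N"
    using psubset_card_mono[of "{1..N}" S] S x unfolding m_def by fastforce
  obtain p where p: "p permutes {1..N}" "p ` {1..m} = S"
    using exists_permutation_prefix[OF S(1)] m_def by blast
  \<comment> \<open>Column position \<open>i\<close> receives the partner of row \<open>p i\<close>,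
    so the first \<open>m\<close> columns are those matched with \<open>S\<close>. Outside the range
    \<open>q\<close> is the identity, as \<open>permutes\<close> demands.\<close>
  define q where "q i = (if i \<in> {1..N} then f (p i) else i)" for i
  have "bij_betw (f \<circ> p) {1..N} {1..N}"
    using permutes_imp_bij[OF p(1)] f by (rule bij_betw_trans)
  then have "bij_betw q {1..N} {1..N}"
    by (rule bij_betw_cong[THEN iffD1, rotated]) (simp add: q_def)
  then have q: "q permutes {1..N}"
    by (rule bij_imp_permutes) (auto simp: q_def)
  have "p i \<notin> S" if "i \<in> {m + 1..N}" for i
    using that unfolding p(2)[symmetric] by (auto simp: inj_eq[OF permutes_inj[OF p(1)]])
  moreover have "p i \<in> {1..N}" if "i \<in> {1..N}" for i
    using that permutes_in_image[OF p(1)] by blast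
  ultimately have "(p i, q j) \<notin> A" if "i \<in> {m + 1..N}" "j \<in> {1..m}" for i j
    using that closed[of "p i" "p j"] p(2) \<open>m < N\<close> by (auto simp: q_def)
  then have "BTF N p q [m, N - m] A"
    using p(1) q \<open>m > 0\<close> \<open>m < N\<close>
    by (auto simp: BTF_def square_block_form_def permuted_pattern_def block_def block_offset_def
        less_Suc_eq)
  then show False
    using irr unfolding irreducible_pattern_def by (metis One_nat_def Suc_1 length_Cons lessI list.size(3))
qed

section \<open>Block coordinates\<close>

lemma block_offset_Suc: "l < length Ns \<Longrightarrow> block_offset Ns (Suc l) = block_offset Ns l + Ns ! l"
  by (simp add: block_offset_def take_Suc_conv_app_nth)

lemma block_offset_mono: "k \<le> l \<Longrightarrow> block_offset Ns k \<le> block_offset Ns l"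
proof (induction l rule: dec_induct)
  case (step l)
  \<comment> \<open>Beyond the end of \<open>Ns\<close> the offsets stay constant, since
    \<open>take\<close> returns the whole list.\<close>
  then show ?case by (cases "l < length Ns") (auto simp: block_offset_Suc, simp add: block_offset_def)
qed simp

lemma block_iff_coordinate:
  "l < length Ns \<Longrightarrow> x \<in> block Ns l \<longleftrightarrow> (\<exists>a\<in>{1..Ns ! l}. x = block_offset Ns l + a)"
  by (auto simp: block_def block_offset_Suc intro!: bexI[of _ "x - block_offset Ns l"])

lemma block_subset: "l < length Ns \<Longrightarrow> block Ns l \<subseteq> {1..sum_list Ns}"
  using block_offset_mono[of "Suc l" "length Ns" Ns] by (auto simp: block_def block_offset_def)

text \<open>Offsets increase weakly, so the first block whose right end reaches \<open>x\<close> is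
  the one containing \<open>x\<close>. The value is meaningful only for positions: \<open>0\<close>
  gets index \<open>0\<close> but lies in no block.\<close>

definition block_index :: "nat list \<Rightarrow> nat \<Rightarrow> nat" where
  "block_index Ns x = (LEAST l. x \<le> block_offset Ns (Suc l))"

lemma block_index_eq:
  assumes "x \<in> block Ns l"
  shows "block_index Ns x = l"
  unfolding block_index_def
proof (rule Least_equality)
  fix k assume "x \<le> block_offset Ns (Suc k)"
  then show "l \<le> k"
    using assms block_offset_mono[of "Suc k" l Ns] by (fastforce simp: block_def not_less_eq_eq)
qed (use assms in \<open>simp add: block_def\<close>)

lemma block_index:
  assumes "x \<in> {1..sum_list Ns}"
  shows "block_index Ns x < length Ns" "x \<in> block Ns (block_index Ns x)"
proof -
  let ?l = "block_index Ns x"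
  obtain k where k: "length Ns = Suc k"
    \<comment> \<open>A nonempty range excludes the empty list; the last block index
      \<open>k\<close> then witnesses that the \<open>LEAST\<close> exists.\<close>
    using assms by (cases Ns) auto
  then have top: "x \<le> block_offset Ns (Suc k)"
    using assms by (simp add: block_offset_def flip: k)
  show "?l < length Ns"
    unfolding k block_index_def using Least_le[of "\<lambda>l. x \<le> block_offset Ns (Suc l)", OF top] by simp
  have "x \<le> block_offset Ns (Suc ?l)"
    unfolding block_index_def by (rule LeastI[of "\<lambda>l. x \<le> block_offset Ns (Suc l)", OF top])
  moreover have "block_offset Ns ?l < x"
  proof (cases ?l)
    case 0
    then show ?thesis using assms by (simp add: block_offset_def)
  next
    case (Suc m)
    then have "\<not> x \<le> block_offset Ns (Suc m)"
      using not_less_Least[of m "\<lambda>l. x \<le> block_offset Ns (Suc l)"] by (simp add: block_index_def)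
    then show ?thesis using Suc by simp
  qed
  ultimately show "x \<in> block Ns ?l"
    by (simp add: block_def)
qed

text \<open>Blocks of labels become level sets of a function on labels, so they can be compared
  without mentioning positions.\<close>

lemma permutes_block_image:
  assumes p: "p permutes {1..sum_list Ns}" and l: "l < length Ns"
  shows "p ` block Ns l = {i \<in> {1..sum_list Ns}. block_index Ns (inv p i) = l}"
proof (intro equalityI subsetI)
  fix i assume "i \<in> p ` block Ns l"
  then obtain x where x: "x \<in> block Ns l" "i = p x" by blast
  moreover have "x \<in> {1..sum_list Ns}"
    using x block_subset[OF l] by blast
  ultimately show "i \<in> {i \<in> {1..sum_list Ns}. block_index Ns (inv p i) = l}"
    using permutes_in_image[OF p, of x] by (simp add: permutes_inverses[OF p] block_index_eq)
next
  fix i assume i: "i \<in> {i \<in> {1..sum_list Ns}. block_index Ns (inv p i) = l}"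
  then have "inv p i \<in> {1..sum_list Ns}"
    using permutes_in_image[OF permutes_inv[OF p]] by blast
  then have "inv p i \<in> block Ns l"
    using block_index(2) i by force
  then show "i \<in> p ` block Ns l"
    by (rule rev_image_eqI) (simp add: permutes_inverses[OF p])
qed

section \<open>Decomposition into strongly connected diagonal blocks\<close>

text \<open>\<open>rb\<close> and \<open>cb\<close> are the block numbers of rows and columns.\<close>

locale block_decomposition =
  fixes n :: nat and A :: "(nat \<times> nat) set" and rb cb :: "nat \<Rightarrow> nat" and g :: "nat \<Rightarrow> nat"
  assumes upper: "\<lbrakk>i \<in> {1..n}; j \<in> {1..n}; (i, j) \<in> A\<rbrakk> \<Longrightarrow> rb i \<le> cb j"
    and g_bij: "bij_betw g {1..n} {1..n}"
    and g_in: "i \<in> {1..n} \<Longrightarrow> (i, g i) \<in> A"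
    and g_block: "i \<in> {1..n} \<Longrightarrow> cb (g i) = rb i"
    and connected: "\<lbrakk>i \<in> {1..n}; i' \<in> {1..n}; rb i = rb i'\<rbrakk> \<Longrightarrow>
      (i, i') \<in> (match_graph {1..n} g {(i, j) \<in> A. rb i = cb j})\<^sup>*"
begin

text \<open>Each \<open>rb i\<close> is at most \<open>cb (f i)\<close>. The reference transversal
  \<open>g\<close> shows that both sides have the same sum, because \<open>f\<close> and
  \<open>g\<close> run through the same columns; hence every inequality is tight.\<close>

lemma transversal_in_diagonal:
  assumes f: "bij_betw f {1..n} {1..n}" "\<forall>i\<in>{1..n}. (i, f i) \<in> A" and i: "i \<in> {1..n}"
  shows "rb i = cb (f i)"
proof -
  have "(\<Sum>i\<in>{1..n}. rb i) = (\<Sum>i\<in>{1..n}. cb (g i))"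
    by (simp add: g_block)
  also have "\<dots> = (\<Sum>i\<in>{1..n}. cb (f i))"
    using sum.reindex_bij_betw[OF g_bij, of cb] sum.reindex_bij_betw[OF f(1), of cb] by simp
  finally show ?thesis
    by (rule sum_mono_inv) (use upper f i bij_betwE[OF f(1)] in auto)
qed

text \<open>
  For an entry \<open>(i, g i')\<close> of a diagonal block, a path from \<open>i'\<close> to \<open>i\<close> closes up to a cycle, along
  which \<open>g\<close> is rotated to a transversal through that entry.
\<close>

lemma transversal_union_eq:
  "transversal_union n A = {(i, j) \<in> A. i \<in> {1..n} \<and> j \<in> {1..n} \<and> rb i = cb j}"
proof (intro equalityI subrelI)
  fix i j assume "(i, j) \<in> transversal_union n A"
  then obtain f where f: "i \<in> {1..n}" "bij_betw f {1..n} {1..n}"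
    "\<forall>x\<in>{1..n}. (x, f x) \<in> A" "j = f i"
    unfolding transversal_union_iff by blast
  then show "(i, j) \<in> {(i, j) \<in> A. i \<in> {1..n} \<and> j \<in> {1..n} \<and> rb i = cb j}"
    using transversal_in_diagonal[of f i] bij_betwE[OF f(2)] by blast
next
  fix i j assume "(i, j) \<in> {(i, j) \<in> A. i \<in> {1..n} \<and> j \<in> {1..n} \<and> rb i = cb j}"
  then have ij: "(i, j) \<in> A" "i \<in> {1..n}" "j \<in> {1..n}" "rb i = cb j"
    by auto
  then obtain i' where i': "i' \<in> {1..n}" "j = g i'"
    using g_bij unfolding bij_betw_def by blast
  define E where "E = match_graph {1..n} g {(i, j) \<in> A. rb i = cb j}"
  have reach: "(i', i) \<in> E\<^sup>*"
    unfolding E_def using connected i' ij g_block by simp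
  obtain X p where path: "path_cycle E i' X p i"
    using rtrancl_imp_path_cycle[OF reach] by (elim exE)
  have p: "p permutes X" "p i = i'" "\<forall>u\<in>X - {i}. (u, p u) \<in> E" "X \<subseteq> insert i' (snd ` E)"
    using path_cycle_permutation[OF path] by blast+
  have "X \<subseteq> {1..n}"
    using p(4) i' unfolding E_def match_graph_def by auto
  then have perm: "p permutes {1..n}"
    by (rule permutes_subset[OF p(1)])
  have "bij_betw (g \<circ> p) {1..n} {1..n}"
    using permutes_imp_bij[OF perm] g_bij by (rule bij_betw_trans)
  \<comment> \<open>Along the path the edges of \<open>E\<close> supply the entries, at its end
    \<open>i\<close> the closing step gives \<open>(i, g i')\<close>, and elsewhere \<open>g\<close>
    is unchanged.\<close>
  moreover have "(u, (g \<circ> p) u) \<in> A" if "u \<in> {1..n}" for u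
  proof (cases "u \<in> X - {i}")
    case True
    then show ?thesis using p(3) by (auto simp: E_def match_graph_def)
  next
    case False
    then show ?thesis
      using p(1,2) ij(1) i' g_in that by (cases "u = i") (auto simp: permutes_not_in)
  qed
  ultimately show "(i, j) \<in> transversal_union n A"
    unfolding transversal_union_iff using ij(2) i' p(2) by (metis comp_apply)
qed

end

section \<open>Connected components of the union of all transversals\<close>

definition row_graph :: "(nat \<times> nat) set \<Rightarrow> (nat \<times> nat) set" where
  "row_graph M = {(i, i'). \<exists>j. (i, j) \<in> M \<and> (i', j) \<in> M}"

text \<open>The connected components of the bipartite graph \<open>M\<close>, each given by its rows
  and columns; \<open>row_graph M\<close> is symmetric, so reachability is connectedness. No block
  form enters, which is the source of uniqueness of the emblem.\<close>

definition component_emblem :: "nat \<Rightarrow> (nat \<times> nat) set \<Rightarrow> (nat set \<times> nat set) set" where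
  "component_emblem n M =
     (\<lambda>i. ((row_graph M)\<^sup>* `` {i}, M `` ((row_graph M)\<^sup>* `` {i}))) ` {1..n}"

context block_decomposition
begin

lemma row_component:
  assumes i: "i \<in> {1..n}"
  shows "(row_graph (transversal_union n A))\<^sup>* `` {i} = {i' \<in> {1..n}. rb i' = rb i}"
proof (intro equalityI subsetI)
  fix i' assume "i' \<in> (row_graph (transversal_union n A))\<^sup>* `` {i}"
  then have "(i, i') \<in> (row_graph (transversal_union n A))\<^sup>*" by simp
  then show "i' \<in> {i' \<in> {1..n}. rb i' = rb i}"
    by induction (use i in \<open>auto simp: row_graph_def transversal_union_eq\<close>)
next
  fix i' assume i': "i' \<in> {i' \<in> {1..n}. rb i' = rb i}"
  have "g x \<in> {1..n}" if "x \<in> {1..n}" for x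
    using bij_betwE[OF g_bij] that by blast
  \<comment> \<open>For an edge from \<open>x\<close> to \<open>y\<close>, the rows \<open>x\<close>
    and \<open>y\<close> share the column \<open>g y\<close>: both \<open>(x, g y)\<close> and
    \<open>(y, g y)\<close> lie in diagonal blocks.\<close>
  then have "match_graph {1..n} g {(i, j) \<in> A. rb i = cb j} \<subseteq> row_graph (transversal_union n A)"
    using g_in g_block unfolding row_graph_def transversal_union_eq match_graph_def
    by (auto simp del: atLeastAtMost_iff)
  then have "(i, i') \<in> (row_graph (transversal_union n A))\<^sup>*"
    using connected[OF i, of i'] i' rtrancl_mono by auto
  then show "i' \<in> (row_graph (transversal_union n A))\<^sup>* `` {i}" by simp
qed

lemma column_component:
  assumes i: "i \<in> {1..n}"
  shows "transversal_union n A `` {i' \<in> {1..n}. rb i' = rb i} = {j \<in> {1..n}. cb j = rb i}"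
proof (intro equalityI subsetI)
  fix j assume j: "j \<in> {j \<in> {1..n}. cb j = rb i}"
  then obtain i' where i': "i' \<in> {1..n}" "j = g i'"
    using g_bij unfolding bij_betw_def by blast
  then have "(i', j) \<in> transversal_union n A" "rb i' = rb i"
    using j g_in g_block unfolding transversal_union_eq by auto
  then show "j \<in> transversal_union n A `` {i' \<in> {1..n}. rb i' = rb i}"
    using i' by blast
qed (auto simp: transversal_union_eq)

lemma component_emblem_eq:
  "component_emblem n (transversal_union n A) =
     (\<lambda>i. ({i' \<in> {1..n}. rb i' = rb i}, {j \<in> {1..n}. cb j = rb i})) ` {1..n}"
  unfolding component_emblem_def
  by (rule image_cong) (simp_all only: row_component column_component)

end

section \<open>Irreducible block forms and their emblems\<close>

locale irreducible_block_form =
  fixes n :: nat and \<rho> \<kappa> :: "nat \<Rightarrow> nat" and Ns :: "nat list" and A :: "(nat \<times> nat) set"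
  assumes irr: "irreducible_BTF n \<rho> \<kappa> Ns A"
begin

lemma btf: "BTF n \<rho> \<kappa> Ns A"
  using irr by (simp add: irreducible_BTF_def)

lemma size: "sum_list Ns = n"
  and row_perm: "\<rho> permutes {1..n}"
  and column_perm: "\<kappa> permutes {1..n}"
  and block_size_pos: "l < length Ns \<Longrightarrow> 0 < Ns ! l"
  using btf by (auto simp: BTF_def square_block_form_def)

definition "row_block i = block_index Ns (inv \<rho> i)"
definition "column_block j = block_index Ns (inv \<kappa> j)"

lemma row_block_image: "l < length Ns \<Longrightarrow> \<rho> ` block Ns l = {i \<in> {1..n}. row_block i = l}"
  and column_block_image: "l < length Ns \<Longrightarrow> \<kappa> ` block Ns l = {j \<in> {1..n}. column_block j = l}"
  using permutes_block_image[of \<rho> Ns l] permutes_block_image[of \<kappa> Ns l] row_perm column_perm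
  by (simp_all only: row_block_def column_block_def size)

lemma row_block_less: "i \<in> {1..n} \<Longrightarrow> row_block i < length Ns"
  and column_block_less: "j \<in> {1..n} \<Longrightarrow> column_block j < length Ns"
  unfolding row_block_def column_block_def
  using block_index(1)[of _ Ns] permutes_in_image[OF permutes_inv[OF row_perm]]
    permutes_in_image[OF permutes_inv[OF column_perm]] by (simp_all add: size)

lemma row_coordinate:
  assumes "i \<in> {1..n}"
  obtains a where "a \<in> {1..Ns ! row_block i}" "i = \<rho> (block_offset Ns (row_block i) + a)"
proof -
  have "i \<in> \<rho> ` block Ns (row_block i)"
    using assms row_block_less by (simp add: row_block_image)
  then show thesis
    using that row_block_less[OF assms] by (auto simp: block_iff_coordinate)
qed

lemma coordinate_block:
  assumes "l < length Ns" "a \<in> {1..Ns ! l}"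
  shows "\<rho> (block_offset Ns l + a) \<in> {1..n}" "row_block (\<rho> (block_offset Ns l + a)) = l"
    "\<kappa> (block_offset Ns l + a) \<in> {1..n}" "column_block (\<kappa> (block_offset Ns l + a)) = l"
proof -
  have "block_offset Ns l + a \<in> block Ns l"
    using assms block_iff_coordinate by blast
  then show "\<rho> (block_offset Ns l + a) \<in> {1..n}" "row_block (\<rho> (block_offset Ns l + a)) = l"
    "\<kappa> (block_offset Ns l + a) \<in> {1..n}" "column_block (\<kappa> (block_offset Ns l + a)) = l"
    using row_block_image[OF assms(1)] column_block_image[OF assms(1)] by blast+
qed

text \<open>Transversals of the diagonal sub-patterns are glued to one transversal \<open>g\<close>,
  and strong connectivity is carried over from each block's local coordinates to labels.\<close>

lemma exists_block_decomposition: "\<exists>g. block_decomposition n A row_block column_block g"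
proof -
  define D where "D l = diag_subpattern Ns l (permuted_pattern n \<rho> \<kappa> A)" for l
  have irrD: "irreducible_pattern (Ns ! l) (D l)" if "l < length Ns" for l
    using irr that by (simp add: irreducible_BTF_def D_def)
  have D_iff: "(a, b) \<in> D l \<longleftrightarrow>
      (\<rho> (block_offset Ns l + a), \<kappa> (block_offset Ns l + b)) \<in> A"
    if "l < length Ns" "a \<in> {1..Ns ! l}" "b \<in> {1..Ns ! l}" for l a b
  proof -
    have "block_offset Ns l + a \<in> {1..n}" "block_offset Ns l + b \<in> {1..n}"
      using that block_subset[OF that(1)] block_iff_coordinate[OF that(1)] size by blast+
    then show ?thesis
      using that by (simp add: D_def diag_subpattern_def permuted_pattern_def)
  qed
  have "\<exists>t. bij_betw t {1..Ns ! l} {1..Ns ! l} \<and> (\<forall>a\<in>{1..Ns ! l}. (a, t a) \<in> D l)"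
    if "l < length Ns" for l
    using irrD[OF that]
    unfolding irreducible_pattern_def structurally_nonsingular_def transversal_iff_bij by blast
  then obtain t where t: "\<And>l. l < length Ns \<Longrightarrow> bij_betw (t l) {1..Ns ! l} {1..Ns ! l}"
    and t_in: "\<And>l a. l < length Ns \<Longrightarrow> a \<in> {1..Ns ! l} \<Longrightarrow> (a, t l a) \<in> D l"
    by metis
  have t_range: "t l a \<in> {1..Ns ! l}" if "l < length Ns" "a \<in> {1..Ns ! l}" for l a
    using bij_betwE[OF t] that by blast
  \<comment> \<open>The difference \<open>inv \<rho> i - off\<close> is the local coordinate of row
    \<open>i\<close> in its block; \<open>t l\<close> acts there, and the result is shifted
    back.\<close>
  define g where "g i = (let l = row_block i; off = block_offset Ns l in
    \<kappa> (off + t l (inv \<rho> i - off)))" for i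
  have g: "g (\<rho> (block_offset Ns l + a)) = \<kappa> (block_offset Ns l + t l a)"
    if "l < length Ns" "a \<in> {1..Ns ! l}" for l a
    using coordinate_block(2)[OF that] by (simp add: g_def permutes_inverses[OF row_perm])
  have g_props: "g i \<in> {1..n}" "(i, g i) \<in> A" "column_block (g i) = row_block i"
    if i: "i \<in> {1..n}" for i
  proof -
    obtain a where a: "a \<in> {1..Ns ! row_block i}" "i = \<rho> (block_offset Ns (row_block i) + a)"
      using row_coordinate[OF i] .
    define l where "l = row_block i"
    have l: "l < length Ns" using row_block_less[OF i] by (simp add: l_def)
    have a': "a \<in> {1..Ns ! l}" "i = \<rho> (block_offset Ns l + a)"
      using a by (simp_all only: l_def)
    show "g i \<in> {1..n}" "(i, g i) \<in> A" "column_block (g i) = row_block i"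
      using coordinate_block(3,4)[OF l t_range[OF l a'(1)]] t_in[OF l a'(1)]
        D_iff[OF l a'(1) t_range[OF l a'(1)]]
      unfolding l_def[symmetric] a'(2) g[OF l a'(1)]
      by (simp_all add: coordinate_block(2)[OF l a'(1)])
  qed
  have "inj_on g {1..n}"
  proof (rule inj_onI)
    fix i i' assume i: "i \<in> {1..n}" and i': "i' \<in> {1..n}" and eq: "g i = g i'"
    \<comment> \<open>Equal columns have equal block numbers, so both rows lie in one block and
      injectivity of \<open>t l\<close> decides.\<close>
    define l where "l = row_block i"
    have l: "l < length Ns" "row_block i = l" "row_block i' = l"
      using row_block_less[OF i] g_props(3)[OF i] g_props(3)[OF i'] eq by (simp_all add: l_def)
    obtain a where a: "a \<in> {1..Ns ! l}" "i = \<rho> (block_offset Ns l + a)"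
      using row_coordinate[OF i] unfolding l(2) .
    obtain a' where a': "a' \<in> {1..Ns ! l}" "i' = \<rho> (block_offset Ns l + a')"
      using row_coordinate[OF i'] unfolding l(3) .
    have "\<kappa> (block_offset Ns l + t l a) = \<kappa> (block_offset Ns l + t l a')"
      using eq unfolding a(2) a'(2) g[OF l(1) a(1)] g[OF l(1) a'(1)] .
    then have "t l a = t l a'"
      by (simp add: inj_eq[OF permutes_inj[OF column_perm]])
    then show "i = i'"
      using t[OF l(1)] a a' by (auto simp: bij_betw_def dest: inj_onD)
  qed
  then have bij: "bij_betw g {1..n} {1..n}"
    using g_props(1) unfolding bij_betw_def by (intro conjI endo_inj_surj) blast+
  have "block_decomposition n A row_block column_block g"
  proof
    fix i j assume ij: "i \<in> {1..n}" "j \<in> {1..n}" "(i, j) \<in> A"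
    obtain x y where x: "x \<in> block Ns (row_block i)" "i = \<rho> x"
      and y: "y \<in> block Ns (column_block j)" "j = \<kappa> y"
      using row_block_image[OF row_block_less] column_block_image[OF column_block_less] ij by blast
    have "x \<in> {1..n}" "y \<in> {1..n}"
      using x y block_subset row_block_less[OF ij(1)] column_block_less[OF ij(2)] size by blast+
    then have "(x, y) \<in> permuted_pattern n \<rho> \<kappa> A"
      using ij x y by (simp add: permuted_pattern_def)
    then show "row_block i \<le> column_block j"
      using btf x(1) y(1) row_block_less[OF ij(1)] column_block_less[OF ij(2)]
      unfolding BTF_def by (meson disjoint_iff mem_Sigma_iff not_le)
  next
    fix i i' assume i: "i \<in> {1..n}" and i': "i' \<in> {1..n}" and eq: "row_block i = row_block i'"
    define l where "l = row_block i"
    have l: "l < length Ns" "row_block i = l" "row_block i' = l"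
      using row_block_less[OF i] eq by (simp_all add: l_def)
    obtain a where a: "a \<in> {1..Ns ! l}" "i = \<rho> (block_offset Ns l + a)"
      using row_coordinate[OF i] unfolding l(2) .
    obtain a' where a': "a' \<in> {1..Ns ! l}" "i' = \<rho> (block_offset Ns l + a')"
      using row_coordinate[OF i'] unfolding l(3) .
    have "(a, a') \<in> (match_graph {1..Ns ! l} (t l) (D l))\<^sup>*"
      using irreducible_strongly_connected[OF irrD t] l(1) a(1) a'(1) by blast
    then have "(\<rho> (block_offset Ns l + a), \<rho> (block_offset Ns l + a')) \<in>
        (match_graph {1..n} g {(i, j) \<in> A. row_block i = column_block j})\<^sup>*"
    proof (rule rtrancl_map)
      fix x y assume "(x, y) \<in> match_graph {1..Ns ! l} (t l) (D l)"
      then have xy: "x \<in> {1..Ns ! l}" "y \<in> {1..Ns ! l}" "(x, t l y) \<in> D l"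
        by (auto simp: match_graph_def)
      show "(\<rho> (block_offset Ns l + x), \<rho> (block_offset Ns l + y)) \<in>
          match_graph {1..n} g {(i, j) \<in> A. row_block i = column_block j}"
        using xy(3) D_iff[OF l(1) xy(1) t_range[OF l(1) xy(2)]]
          coordinate_block[OF l(1) xy(1)] coordinate_block[OF l(1) xy(2)]
          coordinate_block(4)[OF l(1) t_range[OF l(1) xy(2)]] g[OF l(1) xy(2)]
        by (simp add: match_graph_def)
    qed
    then show "(i, i') \<in> (match_graph {1..n} g {(i, j) \<in> A. row_block i = column_block j})\<^sup>*"
      unfolding a(2) a'(2) .
  qed (use bij g_props in auto)
  then show ?thesis by (rule exI[of _ g])
qed

lemma mem_block_iff:
  assumes "l < length Ns" "x \<in> {1..n}"
  shows "x \<in> block Ns l \<longleftrightarrow> row_block (\<rho> x) = l" "x \<in> block Ns l \<longleftrightarrow> column_block (\<kappa> x) = l"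
  using assms block_index(2)[of x Ns] block_index_eq[of x Ns l]
  by (auto simp: row_block_def column_block_def permutes_inverses[OF row_perm]
      permutes_inverses[OF column_perm] size)

lemma permuted_transversal_union:
  "permuted_pattern n \<rho> \<kappa> (transversal_union n A) =
     (\<Union>l<length Ns. permuted_pattern n \<rho> \<kappa> A \<inter> (block Ns l \<times> block Ns l))"
proof -
  obtain g where "block_decomposition n A row_block column_block g"
    using exists_block_decomposition ..
  then interpret block_decomposition n A row_block column_block g .
  have in_range: "\<rho> x \<in> {1..n}" "\<kappa> x \<in> {1..n}" if "x \<in> {1..n}" for x
    using that permutes_in_image[OF row_perm] permutes_in_image[OF column_perm] by blast+
  \<comment> \<open>The only possible \<open>l\<close> is
    \<open>row_block (\<rho> x)\<close>.\<close>
  have "(x, y) \<in> permuted_pattern n \<rho> \<kappa> (transversal_union n A) \<longleftrightarrow>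
      (\<exists>l<length Ns. (x, y) \<in> permuted_pattern n \<rho> \<kappa> A \<and> x \<in> block Ns l \<and> y \<in> block Ns l)" for x y
    using in_range row_block_less[OF in_range(1)] mem_block_iff
    unfolding permuted_pattern_def transversal_union_eq by fastforce
  then show ?thesis by auto
qed

text \<open>The right-hand side depends only on \<open>n\<close> and \<open>A\<close>, so all
  irreducible block forms of \<open>A\<close> have the same emblem.\<close>

lemma emblem_eq: "emblem \<rho> \<kappa> Ns = component_emblem n (transversal_union n A)"
proof -
  obtain g where "block_decomposition n A row_block column_block g"
    using exists_block_decomposition ..
  then interpret block_decomposition n A row_block column_block g .
  \<comment> \<open>Components are indexed by rows and the emblem by blocks; positive block sizes
    ensure that every block number occurs.\<close>
  have "row_block ` {1..n} = {..<length Ns}"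
  proof (intro equalityI subsetI)
    fix l assume l: "l \<in> {..<length Ns}"
    then have "1 \<in> {1..Ns ! l}" using block_size_pos[of l] by simp
    then show "l \<in> row_block ` {1..n}"
      using coordinate_block(1,2)[of l 1] l by (metis imageI lessThan_iff)
  qed (use row_block_less in auto)
  then have "component_emblem n (transversal_union n A) =
      (\<lambda>l. ({i \<in> {1..n}. row_block i = l}, {j \<in> {1..n}. column_block j = l})) ` {..<length Ns}"
    unfolding component_emblem_eq by (auto simp flip: \<open>row_block ` {1..n} = _\<close>)
  also have "\<dots> = emblem \<rho> \<kappa> Ns"
    unfolding emblem_def by (rule image_cong) (simp_all add: row_block_image column_block_image)
  finally show ?thesis ..
qed

text \<open>Passing to the union of transversals deletes only entries outside the diagonal blocks,
  so triangularity and the diagonal sub-patterns survive. This makes the locale applicable to the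
  essential pattern.\<close>

lemma irreducible_BTF_transversal_union: "irreducible_BTF n \<rho> \<kappa> Ns (transversal_union n A)"
proof -
  have sub: "permuted_pattern n \<rho> \<kappa> (transversal_union n A) \<subseteq> permuted_pattern n \<rho> \<kappa> A"
    unfolding permuted_transversal_union by blast
  have "diag_subpattern Ns l (permuted_pattern n \<rho> \<kappa> (transversal_union n A)) =
      diag_subpattern Ns l (permuted_pattern n \<rho> \<kappa> A)" if l: "l < length Ns" for l
  proof -
    have "(x, y) \<in> permuted_pattern n \<rho> \<kappa> (transversal_union n A) \<longleftrightarrow>
        (x, y) \<in> permuted_pattern n \<rho> \<kappa> A" if "x \<in> block Ns l" "y \<in> block Ns l" for x y
      unfolding permuted_transversal_union using l that by auto
    then show ?thesis
      unfolding diag_subpattern_def using block_iff_coordinate[OF l] by blast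
  qed
  moreover have "BTF n \<rho> \<kappa> Ns (transversal_union n A)"
    using btf sub unfolding BTF_def by blast
  ultimately show ?thesis
    using irr by (simp add: irreducible_BTF_def)
qed

lemma is_irreducible_emblem_component_emblem:
  "is_irreducible_emblem n A (component_emblem n (transversal_union n A))"
  unfolding is_irreducible_emblem_def
  \<comment> \<open>The exported form of \<open>emblem_eq\<close> is needed, since it ranges over
    all block forms and not just the fixed one.\<close>
  using irr irreducible_block_form.emblem_eq[unfolded irreducible_block_form_def] by blast

end

theorem theorem4p5:
  fixes n :: nat
    and \<sigma> :: "nat \<Rightarrow> nat \<Rightarrow> int extended"
    and c d :: "nat \<Rightarrow> int"
    and \<rho> \<kappa> :: "nat \<Rightarrow> nat"
    and Ns :: "nat list"
  assumes "signature_matrix n \<sigma>"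
    and "structurally_well_posed n \<sigma>"
    and "valid_offset n \<sigma> c d"
    and "irreducible_BTF n \<rho> \<kappa> Ns (jac_pattern n \<sigma> c d)"
  shows "permuted_pattern n \<rho> \<kappa> (ess_pattern n \<sigma>) =
           (\<Union>l<length Ns. permuted_pattern n \<rho> \<kappa> (jac_pattern n \<sigma> c d) \<inter> (block Ns l \<times> block Ns l))
       \<and> (\<exists>E. is_irreducible_emblem n (jac_pattern n \<sigma> c d) E \<and>
              is_irreducible_emblem n (ess_pattern n \<sigma>) E)"
proof -
  let ?S = "jac_pattern n \<sigma> c d"
  interpret S: irreducible_block_form n \<rho> \<kappa> Ns ?S
    by unfold_locales (rule assms(4))
  interpret ess: irreducible_block_form n \<rho> \<kappa> Ns "transversal_union n ?S"
    by unfold_locales (rule S.irreducible_BTF_transversal_union)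
  show ?thesis
    \<comment> \<open>Idempotence of \<open>transversal_union\<close> identifies the component
      emblems of the two patterns.\<close>
    unfolding ess_pattern_eq_transversal_union[OF assms(3)]
    using S.permuted_transversal_union S.is_irreducible_emblem_component_emblem
      ess.is_irreducible_emblem_component_emblem
    unfolding transversal_union_idem by blast
qed

end
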